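(* For each $n$-point set $P\subset\mathbb{R}^2$ there exists an $n$-point set $P'\subset\mathbb{Q}^2$ with $S_{\square}(P')\ge S_{\square}(P)$.
   Context: An $n$-point set is a set of cardinality $n$ ($n$ a positive integer). For a finite set $P\subset\mathbb{R}^2$, $S_{\square}(P)$ denotes the number of squares contained in $P$, i.e. the number of $4$-element subsets of $P$ that are the vertex set of a (non-degenerate, arbitrarily oriented) square. *)

theory Defs
  imports "HOL-Analysis.Analysis"
begin

text \<open>The vertices are traversed in the cyclic order a, b, c, d: the four sides are equal
  and the four angles are right. The condition that a and b differ excludes the degenerate
  case, and no orientation is imposed.\<close>

definition is_square :: "(real^2) set \<Rightarrow> bool" where
  "is_square Q \<longleftrightarrow> (\<exists>a b c d. Q = {a, b, c, d} \<and> a \<noteq> b \<and>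
     dist a b = dist b c \<and> dist b c = dist c d \<and> dist c d = dist d a \<and>
     orthogonal (d - a) (b - a) \<and> orthogonal (a - b) (c - b) \<and>
     orthogonal (b - c) (d - c) \<and> orthogonal (c - d) (a - d))"

definition num_squares :: "(real^2) set \<Rightarrow> nat" where
  "num_squares P = card {Q. Q \<subseteq> P \<and> card Q = 4 \<and> is_square Q}"

definition rational_plane :: "(real^2) set" where
  "rational_plane = {x. \<forall>i. x $ i \<in> \<rat>}"

end

theory Submission
  imports Defs
begin

text \<open>
  View the real numbers as a vector space over the rationals. A finite set of nonzero reals is
  avoided by the kernel of some rational linear functional, so there is an additive map from the
  reals to the rationals that separates the coordinates of the points of P. Applied
  coordinatewise it is injective on P and commutes with the rotation by a right angle. Hence it
  maps squares to squares, because a square has the form a, a + u, a + u + Ju, a + Ju with J this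
  rotation.
\<close>

lemma vector_space_real_over_rat:
  "vector_space (\<lambda>(q::rat) (x::real). of_rat q * x)"
  by unfold_locales (simp_all add: algebra_simps of_rat_add of_rat_mult)

lemma vector_space_rat_over_rat:
  "vector_space ((*) :: rat \<Rightarrow> rat \<Rightarrow> rat)"
  by unfold_locales (simp_all add: algebra_simps)

text \<open>A nonzero real is linearly independent over the rationals, so prescribing the value 1 at
  \<open>x\<close> extends to a rational linear functional on all reals.\<close>

lemma exists_additive_rat_nonzero_at:
  fixes x :: real
  assumes "x \<noteq> 0"
  shows "\<exists>\<phi>::real \<Rightarrow> rat. Modules.additive \<phi> \<and> \<phi> x \<noteq> 0"
proof -
  interpret vs: vector_space_pair "\<lambda>(q::rat) (x::real). of_rat q * x" "(*) :: rat \<Rightarrow> rat \<Rightarrow> rat"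
    by (intro vector_space_pair.intro vector_space_real_over_rat vector_space_rat_over_rat)
  have "vs.vs1.independent {x}"
    using assms vs.vs1.dependent_single by blast
  from vs.linear_independent_extend[OF this, of "\<lambda>_. 1"]
  obtain \<phi> where lin: "Vector_Spaces.linear (\<lambda>(q::rat) (x::real). of_rat q * x) (*) \<phi>"
    and "\<phi> x = 1" by auto
  moreover have "Modules.additive \<phi>"
    using vs.linear_add[OF lin] by (simp add: Modules.additive_def)
  ultimately show ?thesis by (intro exI[of _ \<phi>]) simp
qed

text \<open>Induction on \<open>D\<close>: if \<phi> works on \<open>D\<close> and \<psi> is nonzero
  at the new point, then \<phi> plus a rational multiple of \<psi> works on both, since only
  finitely many multipliers are bad.\<close>

lemma exists_additive_rat_nonzero_on:
  fixes D :: "real set"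
  assumes "finite D" "0 \<notin> D"
  shows "\<exists>\<phi>::real \<Rightarrow> rat. Modules.additive \<phi> \<and> (\<forall>x\<in>D. \<phi> x \<noteq> 0)"
  using assms
proof (induction D rule: finite_induct)
  case empty
  then show ?case by (intro exI[of _ "\<lambda>_. 0"]) (simp add: Modules.additive_def)
next
  case (insert x D)
  then obtain \<phi> :: "real \<Rightarrow> rat" where \<phi>: "Modules.additive \<phi>" "\<forall>y\<in>D. \<phi> y \<noteq> 0" by auto
  obtain \<psi> :: "real \<Rightarrow> rat" where \<psi>: "Modules.additive \<psi>" "\<psi> x \<noteq> 0"
    using exists_additive_rat_nonzero_at insert.prems by (metis insertI1)
  \<comment> \<open>For each \<open>y\<close> with \<open>\<psi> y\<close> nonzero, the quotient in
    the image is the only multiplier at which the combination vanishes at \<open>y\<close>.\<close>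
  obtain t :: rat where t: "t \<notin> insert 0 ((\<lambda>y. - \<phi> y / \<psi> y) ` insert x D)"
    using ex_new_if_finite[OF infinite_UNIV_char_0] insert.hyps
    by (metis finite_imageI finite_insert)
  have "Modules.additive (\<lambda>y. \<phi> y + t * \<psi> y)"
    using \<phi>(1) \<psi>(1) by (simp add: Modules.additive_def algebra_simps)
  moreover have "\<phi> y + t * \<psi> y \<noteq> 0" if y: "y \<in> insert x D" for y
  proof (cases "\<psi> y = 0")
    case True
    \<comment> \<open>Since \<psi> is nonzero at \<open>x\<close>, the point \<open>y\<close> lies
      in \<open>D\<close>, where \<phi> does not vanish.\<close>
    with y \<psi>(2) \<phi>(2) show ?thesis by auto
  next
    case False
    have "t \<noteq> - \<phi> y / \<psi> y" using t y by blast
    with False show ?thesis by (simp add: field_simps)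
  qed
  ultimately show ?case by (intro exI[of _ "\<lambda>y. \<phi> y + t * \<psi> y"]) simp
qed

definition rot90 :: "real^2 \<Rightarrow> real^2" where
  "rot90 v = vector [- v $ 2, v $ 1]"

lemma rot90_nth [simp]: "rot90 v $ 1 = - v $ 2" "rot90 v $ 2 = v $ 1"
  by (simp_all add: rot90_def)

lemma norm_rot90 [simp]: "norm (rot90 v) = norm v"
  by (simp add: norm_eq_sqrt_inner inner_vec_def sum_2)

lemma inner_rot90 [simp]: "v \<bullet> rot90 v = 0" "rot90 v \<bullet> v = 0"
  by (simp_all add: inner_vec_def sum_2)

text \<open>The determinant \<open>d\<close> of \<open>u\<close> and \<open>w\<close> is plus or
  minus the squared norm \<open>N\<close>, and its sign decides which of the two quarter turns of
  \<open>u\<close> is \<open>w\<close>.\<close>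

lemma orthogonal_eq_norm_imp_rot90:
  assumes "orthogonal u w" "norm u = norm w"
  shows "w = rot90 u \<or> w = - rot90 u"
proof -
  have o: "u$1 * w$1 + u$2 * w$2 = 0"
    using assms(1) by (simp add: orthogonal_def inner_vec_def sum_2)
  have n: "u$1 * u$1 + u$2 * u$2 = w$1 * w$1 + w$2 * w$2"
    using assms(2) by (simp add: norm_eq_sqrt_inner inner_vec_def sum_2)
  define N where "N = u$1 * u$1 + u$2 * u$2"
  define d where "d = u$1 * w$2 - u$2 * w$1"
  \<comment> \<open>Lagrange's identity in the plane.\<close>
  have "d * d + (u$1 * w$1 + u$2 * w$2) * (u$1 * w$1 + u$2 * w$2)
      = N * (w$1 * w$1 + w$2 * w$2)"
    by (simp add: d_def N_def algebra_simps)
  then have "d * d = N * N" using o n by (simp add: N_def)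
  then consider "d = N" | "d = - N" by (auto simp: square_eq_iff)
  then show ?thesis
  proof cases
    case 1
    \<comment> \<open>The left side is the squared norm of \<open>w - rot90 u\<close>; in the other
      case it is that of \<open>w + rot90 u\<close>.\<close>
    have "(w$1 + u$2)\<^sup>2 + (w$2 - u$1)\<^sup>2 = N + (w$1 * w$1 + w$2 * w$2) - 2 * d"
      by (simp add: d_def N_def power2_eq_square algebra_simps)
    also have "\<dots> = 0" using 1 n by (simp add: N_def)
    finally have "w$1 + u$2 = 0" "w$2 - u$1 = 0"
      by (simp_all only: sum_power2_eq_zero_iff)
    then have "w = rot90 u"
      by (simp add: vec_eq_iff forall_2 add_eq_0_iff)
    then show ?thesis ..
  next
    case 2
    have "(w$1 - u$2)\<^sup>2 + (w$2 + u$1)\<^sup>2 = N + (w$1 * w$1 + w$2 * w$2) + 2 * d"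
      by (simp add: d_def N_def power2_eq_square algebra_simps)
    also have "\<dots> = 0" using 2 n by (simp add: N_def)
    finally have "w$1 - u$2 = 0" "w$2 + u$1 = 0"
      by (simp_all only: sum_power2_eq_zero_iff)
    then have "w = - rot90 u"
      by (simp add: vec_eq_iff forall_2 add_eq_0_iff)
    then show ?thesis ..
  qed
qed

text \<open>By Pythagoras the squared norm on the left is five times that of \<open>u\<close>. This
  excludes the case where the sides at \<open>a\<close> and \<open>b\<close> leave \<open>ab\<close>
  in opposite directions.\<close>

lemma norm_diff_two_perp_neq:
  fixes u w :: "'a::real_inner"
  assumes "u \<bullet> w = 0" "norm w = norm u" "u \<noteq> 0"
  shows "norm (u - 2 *\<^sub>R w) \<noteq> norm u"
proof
  assume "norm (u - 2 *\<^sub>R w) = norm u"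
  moreover have "w \<bullet> w = u \<bullet> u"
    using assms(2) by (simp add: norm_eq_sqrt_inner)
  ultimately show False
    using assms by (simp add: norm_eq_sqrt_inner inner_diff inner_commute)
qed

text \<open>The right side uses only addition and \<open>rot90\<close>, so it can be transported by
  an additive map that commutes with \<open>rot90\<close>, although such a map need not respect
  distances or angles.\<close>

lemma is_square_iff:
  "is_square Q \<longleftrightarrow> (\<exists>a u. u \<noteq> 0 \<and> Q = {a, a + u, a + u + rot90 u, a + rot90 u})"
proof
  assume "is_square Q"
  then obtain a b c d where Q: "Q = {a, b, c, d}" and ne: "a \<noteq> b"
    and d1: "dist a b = dist b c" and d2: "dist b c = dist c d" and d3: "dist c d = dist d a"
    and o1: "orthogonal (d - a) (b - a)" and o2: "orthogonal (a - b) (c - b)"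
    unfolding is_square_def by blast
  define u where "u = b - a"
  have u0: "u \<noteq> 0" and b: "b = a + u" using ne by (auto simp: u_def)
  have nu: "norm (d - a) = norm u" "norm (c - b) = norm u" "norm (c - d) = norm u"
    using d1 d2 d3 by (simp_all add: u_def dist_norm norm_minus_commute)
  have "d - a = rot90 u \<or> d - a = - rot90 u"
    using o1 nu by (intro orthogonal_eq_norm_imp_rot90) (auto simp: u_def orthogonal_commute)
  moreover have "c - b = rot90 u \<or> c - b = - rot90 u"
  proof (intro orthogonal_eq_norm_imp_rot90)
    show "orthogonal u (c - b)"
      using o2 by (simp add: u_def orthogonal_def inner_diff)
  qed (use nu in simp)
  \<comment> \<open>If \<open>d - a\<close> and \<open>c - b\<close> had opposite signs,
    \<open>c - d\<close> would be one of these two vectors, contradicting the equality of the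
    sides.\<close>
  moreover have "norm (u - 2 *\<^sub>R rot90 u) \<noteq> norm u" "norm (u - 2 *\<^sub>R (- rot90 u)) \<noteq> norm u"
    by (rule norm_diff_two_perp_neq; use u0 in simp)+
  moreover have "c - d = u + (c - b) - (d - a)" by (simp add: u_def)
  then have "c - d = u - 2 *\<^sub>R rot90 u" if "d - a = rot90 u" "c - b = - rot90 u"
    using that by (simp only: scaleR_2) simp
  moreover have "c - d = u - 2 *\<^sub>R (- rot90 u)" if "d - a = - rot90 u" "c - b = rot90 u"
    using that \<open>c - d = u + (c - b) - (d - a)\<close> by (simp only: scaleR_2) simp
  ultimately consider "d - a = rot90 u" "c - b = rot90 u"
    | "d - a = - rot90 u" "c - b = - rot90 u"
    using nu(3) by metis
  then show "\<exists>a u. u \<noteq> 0 \<and> Q = {a, a + u, a + u + rot90 u, a + rot90 u}"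
  proof cases
    case 1
    then have "c = a + u + rot90 u" "d = a + rot90 u"
      by (simp_all add: b algebra_simps)
    then show ?thesis using Q b u0 by blast
  next
    case 2
    \<comment> \<open>The vertices \<open>a, b, c, d\<close> run clockwise here. Starting at
      \<open>d\<close> with the same \<open>u\<close> lists them counterclockwise as
      \<open>d, c, b, a\<close>.\<close>
    then have a: "a = d + rot90 u" and "c = b - rot90 u"
      by (simp_all add: algebra_simps)
    then have "c = d + u" "b = d + u + rot90 u" by (simp_all add: b)
    then have "Q = {d, d + u, d + u + rot90 u, d + rot90 u}" using Q a by auto
    then show ?thesis using u0 by blast
  qed
next
  assume "\<exists>a u. u \<noteq> 0 \<and> Q = {a, a + u, a + u + rot90 u, a + rot90 u}"
  then obtain a u where "u \<noteq> 0" "Q = {a, a + u, a + u + rot90 u, a + rot90 u}" by blast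
  then show "is_square Q"
    unfolding is_square_def
    by (intro exI[of _ a] exI[of _ "a + u"] exI[of _ "a + u + rot90 u"] exI[of _ "a + rot90 u"])
      (simp add: dist_norm orthogonal_def algebra_simps)
qed

text \<open>The pair \<open>a\<close>, \<open>u\<close> describing the square is sent to
  \<open>f a\<close>, \<open>f u\<close>; injectivity on \<open>Q\<close> keeps \<open>f u\<close>
  nonzero.\<close>

lemma is_square_image:
  assumes "Modules.additive f" "\<And>v. f (rot90 v) = rot90 (f v)" "inj_on f Q" "is_square Q"
  shows "is_square (f ` Q)"
proof -
  obtain a u where u0: "u \<noteq> 0" and Q: "Q = {a, a + u, a + u + rot90 u, a + rot90 u}"
    using assms(4) is_square_iff by blast
  have add: "f (x + y) = f x + f y" for x y
    using assms(1) by (simp add: Modules.additive_def)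
  have "f (a + u) \<noteq> f a"
    using inj_onD[OF assms(3), of "a + u" a] u0 Q by auto
  then have "f u \<noteq> 0" by (simp add: add)
  moreover have "f ` Q = {f a, f a + f u, f a + f u + rot90 (f u), f a + rot90 (f u)}"
    by (simp add: Q add assms(2))
  ultimately show ?thesis unfolding is_square_iff by blast
qed

lemma num_squares_le_image:
  assumes "finite P" "inj_on f P"
    and "\<And>Q. Q \<subseteq> P \<Longrightarrow> is_square Q \<Longrightarrow> is_square (f ` Q)"
  shows "num_squares P \<le> num_squares (f ` P)"
  unfolding num_squares_def
proof (rule card_inj_on_le)
  show "inj_on (image f) {Q. Q \<subseteq> P \<and> card Q = 4 \<and> is_square Q}"
    by (rule inj_on_subset[OF inj_on_image_Pow[OF assms(2)]]) auto
  show "image f ` {Q. Q \<subseteq> P \<and> card Q = 4 \<and> is_square Q}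
      \<subseteq> {Q. Q \<subseteq> f ` P \<and> card Q = 4 \<and> is_square Q}"
    using assms(3) by (auto simp: card_image[OF inj_on_subset[OF assms(2)]])
  show "finite {Q. Q \<subseteq> f ` P \<and> card Q = 4 \<and> is_square Q}"
    by (rule finite_subset[of _ "Pow (f ` P)"]) (use assms(1) in auto)
qed

theorem theorem28:
  fixes n :: nat and P :: "(real^2) set"
  assumes "n \<ge> 1" and "finite P" and "card P = n"
  shows "\<exists>P'. P' \<subseteq> rational_plane \<and> finite P' \<and> card P' = n \<and>
           num_squares P' \<ge> num_squares P"
proof -
  \<comment> \<open>If \<phi> vanishes nowhere on these nonzero coordinate differences, it separates
    any two distinct values of the same coordinate on \<open>P\<close>.\<close>
  define D where "D = (\<lambda>(x, y, i). x $ i - y $ i) ` (P \<times> P \<times> (UNIV :: 2 set)) - {0}"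
  have "finite D" "0 \<notin> D" using assms(2) by (auto simp: D_def)
  then obtain \<phi> :: "real \<Rightarrow> rat" where \<phi>: "Modules.additive \<phi>" "\<forall>x\<in>D. \<phi> x \<noteq> 0"
    using exists_additive_rat_nonzero_on by blast
  \<comment> \<open>The same \<phi> acts on both coordinates, because \<open>rot90\<close> exchanges
    them up to sign and \<open>f\<close> has to commute with it.\<close>
  define f :: "real^2 \<Rightarrow> real^2" where "f x = (\<chi> i. of_rat (\<phi> (x $ i)))" for x
  have add: "Modules.additive f"
    using \<phi>(1) by (simp add: Modules.additive_def f_def vec_eq_iff of_rat_add)
  have rot: "f (rot90 v) = rot90 (f v)" for v
    by (simp add: vec_eq_iff forall_2 f_def Modules.additive.minus[OF \<phi>(1)] of_rat_minus)
  have inj: "inj_on f P"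
  proof (rule inj_onI)
    fix x y assume xy: "x \<in> P" "y \<in> P" "f x = f y"
    have "x $ i - y $ i = 0" for i
    proof (rule ccontr)
      assume "x $ i - y $ i \<noteq> 0"
      then have "x $ i - y $ i \<in> D" using xy by (force simp: D_def)
      then have "\<phi> (x $ i) \<noteq> \<phi> (y $ i)"
        using \<phi>(2) Modules.additive.diff[OF \<phi>(1), of "x $ i" "y $ i"] by force
      then show False using xy(3) by (simp add: f_def vec_eq_iff)
    qed
    then show "x = y" by (simp add: vec_eq_iff)
  qed
  have "num_squares P \<le> num_squares (f ` P)"
    using assms(2) inj
    by (rule num_squares_le_image) (use is_square_image add rot inj_on_subset[OF inj] in blast)
  moreover have "f ` P \<subseteq> rational_plane"
    by (auto simp: rational_plane_def f_def)
  ultimately show ?thesis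
    using assms card_image[OF inj] by (intro exI[of _ "f ` P"]) auto
qed

end
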